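(* Let $h$ be a dimension function, let $N\in\mathbb{N}$, and let $\mathcal{F}$ be a family of continuous functions from $\mathbb{R}^N$ to $\mathbb{R}^N$. Suppose there exist a countable family $\Psi=\{\psi_r:\Omega_r\to\mathbb{R}^N\}_{r\in\mathbb{N}}$ of closed, injective, locally bilipschitz functions, each defined on a closed set $\Omega_r\subseteq\mathbb{R}^N$, and an assignment $f\mapsto r(f)\in\mathbb{N}$ for $f\in\mathcal{F}$, such that: (i) for every $r$, $\lim_{\|x\|\to+\infty,\ x\in\Omega_r}\|\psi_r(x)\|=+\infty$; (ii) for each $f\in\mathcal{F}$, the composition $f\circ\psi_{r(f)}$ is a non-contractive bilipschitz map on $\Omega_{r(f)}$; (iii) for any finitely many functions $f_1,\dots,f_n\in\mathcal{F}$ and every $a>0$, the set $$A_{a,f_1,\dots,f_n}:=\bigcap_{1\le i\le n}\bigl(f_i\circ\psi_{r(f_i)}\bigr)\Bigl(\Omega_{r(f_i)}\cap\bigl(\mathbb{R}^N\setminus(-a,a)^N\bigr)\Bigr)$$ contains arbitrarily large balls. Then there exists a perfect set $E\subseteq\mathbb{R}^N$ such that $\mathcal{H}^h(E)=0$ and $\bigcap_{1\le i\le n}f_i(E)\neq\emptyset$ for any finite subset $\{f_1,\dots,f_n\}\subseteq\mathcal{F}$.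
   Context: A dimension function is a function $h:\mathbb{R}_{\ge0}\to\mathbb{R}\cup\{+\infty\}$ that is non-decreasing and right continuous, with $h(0)=0$ and $h(t)>0$ for $t>0$. The associated (outer) Hausdorff measure is $\mathcal{H}^h(E)=\lim_{\delta\to0}\inf\{\sum_i h(|U_i|):\{U_i\}_i\text{ a (countable) }\delta\text{-covering of }E\}$, where $|U|$ is the diameter of $U$ and a $\delta$-covering is a covering by sets of diameter at most $\delta$. A map $g:X\to\mathbb{R}^N$, $X\subseteq\mathbb{R}^N$, is bilipschitz with constants $(c_1,c_2)$, $c_1,c_2>0$, if $c_1\|x-y\|\le\|g(x)-g(y)\|\le c_2\|x-y\|$ for all $x,y\in X$; it is non-contractive bilipschitz if this holds with some $c_1\ge1$. A map $\psi:\Omega\to\mathbb{R}^N$, $\Omega\subseteq\mathbb{R}^N$, is locally bilipschitz if for every $x_0\in\Omega$ there are $\varepsilon>0$ and $c_1,c_2>0$ (depending on $x_0$) such that $c_1\|x-y\|\le\|\psi(x)-\psi(y)\|\le c_2\|x-y\|$ for all $x,y\in B(x_0,\varepsilon)\cap\Omega$. A map is closed if it sends closed subsets of its domain to closed subsets of its codomain. A set contains arbitrarily large balls if for every $\rho>0$ it contains a ball of $\mathbb{R}^N$ of radius $\rho$. A perfect set is a closed set without isolated points. *)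

theory Defs
  imports "HOL-Analysis.Analysis"
begin

(* A dimension function is determined by its values on [0, +oo); the values at negative reals are
   junk.  Since h 0 = 0 and h is non-decreasing, h is non-negative, so the codomain
   R together with +oo is rendered by ennreal. *)
definition dimension_function :: "(real \<Rightarrow> ennreal) \<Rightarrow> bool" where
  "dimension_function h \<longleftrightarrow>
     mono_on {0..} h \<and> (\<forall>t\<ge>0. continuous (at_right t) h) \<and> h 0 = 0 \<and> (\<forall>t>0. h t > 0)"

(* Finite coverings are included: pad with the empty set, whose library diameter is 0 and which
   contributes h 0 = 0.  The library diameter of an unbounded set is an unspecified real, hence
   the explicit boundedness requirement. *)
definition delta_covering :: "real \<Rightarrow> 'a::metric_space set \<Rightarrow> (nat \<Rightarrow> 'a set) \<Rightarrow> bool" where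
  "delta_covering \<delta> E U \<longleftrightarrow> E \<subseteq> (\<Union>i. U i) \<and> (\<forall>i. bounded (U i) \<and> diameter (U i) \<le> \<delta>)"

definition hausdorff_measure :: "(real \<Rightarrow> ennreal) \<Rightarrow> 'a::metric_space set \<Rightarrow> ennreal" where
  "hausdorff_measure h E =
     Lim (at_right 0) (\<lambda>\<delta>. INF U\<in>{U. delta_covering \<delta> E U}. \<Sum>i. h (diameter (U i)))"

definition bilipschitz_on ::
    "real \<Rightarrow> real \<Rightarrow> 'a::metric_space set \<Rightarrow> ('a \<Rightarrow> 'b::metric_space) \<Rightarrow> bool" where
  "bilipschitz_on c1 c2 X g \<longleftrightarrow> 0 < c1 \<and> 0 < c2 \<and>
     (\<forall>x\<in>X. \<forall>y\<in>X. c1 * dist x y \<le> dist (g x) (g y) \<and> dist (g x) (g y) \<le> c2 * dist x y)"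

definition noncontractive_bilipschitz_on ::
    "'a::metric_space set \<Rightarrow> ('a \<Rightarrow> 'b::metric_space) \<Rightarrow> bool" where
  "noncontractive_bilipschitz_on X g \<longleftrightarrow> (\<exists>c1 c2. 1 \<le> c1 \<and> bilipschitz_on c1 c2 X g)"

definition locally_bilipschitz_on ::
    "'a::metric_space set \<Rightarrow> ('a \<Rightarrow> 'b::metric_space) \<Rightarrow> bool" where
  "locally_bilipschitz_on X g \<longleftrightarrow>
     (\<forall>x0\<in>X. \<exists>\<epsilon>>0. \<exists>c1 c2. bilipschitz_on c1 c2 (ball x0 \<epsilon> \<inter> X) g)"

definition contains_arbitrarily_large_balls :: "'a::metric_space set \<Rightarrow> bool" where
  "contains_arbitrarily_large_balls S \<longleftrightarrow> (\<forall>\<rho>>0. \<exists>x. ball x \<rho> \<subseteq> S)"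

(* The empty set counts as perfect. *)
definition perfect_set :: "'a::topological_space set \<Rightarrow> bool" where
  "perfect_set E \<longleftrightarrow> closed E \<and> (\<forall>x\<in>E. \<not> x isolated_in E)"

end

theory Submission
  imports Defs
begin

text \<open>Take lattices of mesh \<open>1 / 3 ^ p j\<close> and tolerances \<open>t j = 3 ^ j / (2 * 3 ^ p (j + 1))\<close>, with
  \<open>p\<close> growing so fast that, for every infinite set \<open>J\<close> of levels, the set of points lying within
  \<open>t j\<close> of the \<open>j\<close>-th lattice in each coordinate for all \<open>j \<in> J\<close> has null locally Lipschitz images.
  Split the levels into infinitely many infinite classes \<open>J i\<close>, and let \<open>E\<close> be the union over
  \<open>i, k\<close> of the images under \<open>\<psi> k\<close> of the closure of the part of the \<open>i\<close>-th set inside the interior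
  of \<open>\<Omega> k\<close> and far from the origin; properness of \<open>\<psi> k\<close> makes this union locally finite. Given
  finitely many functions, assign distinct large indices \<open>i\<close> to them. As each level then constrains
  at most one function, a common value is the limit of nested balls of radius \<open>t j\<close>: by invariance
  of domain the preimage of a ball contains a point of the next lattice, and by non-contractivity
  the ball of radius \<open>t j\<close> around the image of this point pulls back into the ball of radius \<open>t j\<close>
  around the point.\<close>

section \<open>Perfect sets from sparse lattice neighbourhoods\<close>

text \<open>The tolerance is \<open>3 ^ j / 2\<close> meshes of the next lattice. The growing factor
  \<open>3 ^ j\<close> leaves room for points of that lattice whatever the Lipschitz constants are,
  once \<open>j\<close> is large.\<close>

definition level_set :: "(nat \<Rightarrow> nat) \<Rightarrow> nat \<Rightarrow> real set" where
  "level_set p j = {x. \<exists>z::int. \<bar>x - z / 3 ^ p j\<bar> \<le> 3 ^ j / (2 * 3 ^ p (Suc j))}"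

definition ternary_set :: "(nat \<Rightarrow> nat) \<Rightarrow> nat set \<Rightarrow> real set" where
  "ternary_set p J = (\<Inter>j\<in>J. level_set p j)"

text \<open>The increment \<open>j + 2\<close> compensates the factor \<open>3 ^ j\<close> in the
  tolerance and keeps it at or below 1/18 of the mesh of its own level.\<close>

definition fast_growing :: "(nat \<Rightarrow> nat) \<Rightarrow> bool" where
  "fast_growing p \<longleftrightarrow> (\<forall>j. p j + j + 2 \<le> p (Suc j))"

lemma fast_growing_le:
  assumes "fast_growing p"
  shows "j \<le> p j"
proof (induction j)
  case (Suc j)
  have "p j + j + 2 \<le> p (Suc j)" using assms by (auto simp: fast_growing_def)
  then show ?case using Suc by linarith
qed auto

lemma fast_growing_mono:
  assumes "fast_growing p" "i \<le> j"
  shows "p i \<le> p j"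
proof (rule lift_Suc_mono_le[of p])
  show "p n \<le> p (Suc n)" for n using assms(1) 
    by (metis add_leD1 fast_growing_def)
qed (fact assms)

lemma tolerance_le_mesh:
  assumes "fast_growing p"
  shows "(3::real) ^ j / (2 * 3 ^ p (Suc j)) \<le> 1 / (18 * 3 ^ p j)"
proof -
  have "p j + j + 2 \<le> p (Suc j)" using assms by (auto simp: fast_growing_def)
  then have "(3::real) ^ (p j + j + 2) \<le> 3 ^ p (Suc j)" by (intro power_increasing) auto
  then show ?thesis by (simp add: field_simps power_add)
qed

text \<open>This is the sum of a closed set, the scaled integers, and a compact interval.\<close>

lemma closed_level_set: "closed (level_set p j)"
proof -
  let ?t = "(3::real) ^ j / (2 * 3 ^ p (Suc j))"
  have "closed ((\<lambda>x. (1 / 3 ^ p j) *\<^sub>R x) ` (\<int> :: real set))"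
    by (intro closed_scaling) auto
  then have "closed (\<Union>x\<in>(\<lambda>x. (1 / 3 ^ p j) *\<^sub>R x) ` (\<int> :: real set). \<Union>y\<in>cball 0 ?t. {x + y})"
    by (rule closed_compact_sums) auto
  moreover have "(\<Union>x\<in>(\<lambda>x. (1 / 3 ^ p j) *\<^sub>R x) ` (\<int> :: real set). \<Union>y\<in>cball 0 ?t. {x + y})
      = level_set p j" (is "?L = _")
  proof (intro equalityI subsetI)
    fix x assume "x \<in> ?L"
    then obtain z :: int and u where "\<bar>u\<bar> \<le> ?t" "x = z / 3 ^ p j + u"
      by (auto elim!: Ints_cases)
    then have "\<bar>x - z / 3 ^ p j\<bar> \<le> ?t" by simp
    then show "x \<in> level_set p j" unfolding level_set_def by blast
  next
    fix x assume "x \<in> level_set p j"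
    then obtain z :: int where z: "\<bar>x - z / 3 ^ p j\<bar> \<le> ?t" by (auto simp: level_set_def)
    have "x = (1 / 3 ^ p j) *\<^sub>R of_int z + (x - z / 3 ^ p j)" by simp
    moreover have "x - z / 3 ^ p j \<in> cball 0 ?t" using z by simp
    ultimately show "x \<in> ?L" by (metis (no_types, lifting) Ints_of_int UN_I imageI singletonI)
  qed
  ultimately show ?thesis by simp
qed

lemma closed_ternary_set: "closed (ternary_set p J)"
  by (auto simp: ternary_set_def closed_level_set)

text \<open>The endpoints of a coarse interval lie halfway between points of every finer lattice, because
  the ratio of the scales is odd.\<close>
lemma finer_interval_subset:
  fixes a b :: int
  assumes p: "fast_growing p" and "m < j"
    and xa: "\<bar>x - a / 3 ^ p m\<bar> \<le> 3 ^ m / (2 * 3 ^ p (Suc m))"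
    and xb: "\<bar>x - b / 3 ^ p j\<bar> \<le> 3 ^ j / (2 * 3 ^ p (Suc j))"
    and yb: "\<bar>y - b / 3 ^ p j\<bar> \<le> 3 ^ j / (2 * 3 ^ p (Suc j))"
  shows "\<bar>y - a / 3 ^ p m\<bar> \<le> (3::real) ^ m / (2 * 3 ^ p (Suc m))"
proof -
  let ?A = "3 ^ p j :: real"
  \<comment> \<open>Scaling by \<open>?A\<close> turns the lattice of level \<open>j\<close> into
    the integers. The coarse tolerance becomes \<open>3 ^ (m + k) / 2\<close>, half an odd integer,
    and the fine one is at most 1/18.\<close>
  define k where "k = p j - p (Suc m)"
  define l where "l = p j - p m"
  have k: "p j = p (Suc m) + k" and l: "p j = p m + l"
    using fast_growing_mono[OF p, of "Suc m" j] fast_growing_mono[OF p, of m j] \<open>m < j\<close>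
    by (auto simp: k_def l_def)
  define d where "d = b - a * 3 ^ l"
  have t: "?A * (3 ^ m / (2 * 3 ^ p (Suc m))) = 3 ^ (m + k) / 2"
    unfolding k by (simp add: power_add)
  have sa: "?A * (a / 3 ^ p m) = a * 3 ^ l"
    unfolding l by (simp add: power_add)
  have small: "?A * (3 ^ j / (2 * 3 ^ p (Suc j))) \<le> 1 / 18"
    using mult_left_mono[OF tolerance_le_mesh[OF p, of j], of ?A] by simp
  have scale: "\<bar>u - v\<bar> \<le> w \<longleftrightarrow> \<bar>?A * u - ?A * v\<bar> \<le> ?A * w" for u v w :: real
    by (simp add: abs_mult flip: right_diff_distrib)
  have xa': "\<bar>?A * x - a * 3 ^ l\<bar> \<le> 3 ^ (m + k) / 2"
    using xa unfolding scale[of x] t sa by simp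
  have xb': "\<bar>?A * x - b\<bar> \<le> 1 / 18"
    using xb order_trans[OF _ small] unfolding scale[of x] by simp
  have yb': "\<bar>?A * y - b\<bar> \<le> 1 / 18"
    using yb order_trans[OF _ small] unfolding scale[of y] by simp
  have "\<bar>real_of_int d\<bar> \<le> 3 ^ (m + k) / 2 + 1 / 18"
    using xa' xb' unfolding d_def of_int_diff of_int_mult of_int_power of_int_numeral by linarith
  then have "2 * \<bar>real_of_int d\<bar> < 3 ^ (m + k) + 1" by simp
  then have "real_of_int (2 * \<bar>d\<bar>) < real_of_int (3 ^ (m + k) + 1)" by simp
  then have "2 * \<bar>d\<bar> < 3 ^ (m + k) + 1" by (simp only: of_int_less_iff)
  \<comment> \<open>Parity improves the bound: an even number at most an odd one is at most its
    predecessor. The gained 1/2 absorbs the error 1/18 of \<open>y\<close>.\<close>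
  moreover have "odd (3 ^ (m + k) :: int)" by simp
  then obtain q where "(3 ^ (m + k) :: int) = 2 * q + 1" by (rule oddE)
  ultimately have "2 * \<bar>d\<bar> + 1 \<le> 3 ^ (m + k)" by simp
  then have "real_of_int (2 * \<bar>d\<bar> + 1) \<le> real_of_int (3 ^ (m + k))" by (simp only: of_int_le_iff)
  then have "\<bar>real_of_int d\<bar> + 1 / 2 \<le> 3 ^ (m + k) / 2" by simp
  then have "\<bar>?A * y - a * 3 ^ l\<bar> \<le> 3 ^ (m + k) / 2"
    using yb' unfolding d_def of_int_diff of_int_mult of_int_power of_int_numeral by linarith
  then show ?thesis unfolding scale[of y] t sa .
qed

text \<open>For a large level \<open>j\<close> in \<open>J\<close>, move \<open>x\<close> by one
  mesh of level \<open>j + 1\<close> towards the centre of its interval of level \<open>j\<close>.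
  It stays in that interval, hence in its intervals of all coarser levels. For finer levels the
  shift is a lattice vector and changes no distance to the lattice.\<close>

lemma ternary_set_accumulates:
  assumes p: "fast_growing p" and J: "infinite J" and x: "x \<in> ternary_set p J" and "\<epsilon> > 0"
  shows "\<exists>y\<in>ternary_set p J. y \<noteq> x \<and> \<bar>y - x\<bar> < \<epsilon>"
proof -
  obtain n where n: "(1 / 3) ^ n < \<epsilon>"
    using real_arch_pow_inv[of \<epsilon> "1/3"] \<open>\<epsilon> > 0\<close> by auto
  \<comment> \<open>\<open>Suc n\<close> in place of \<open>n\<close> forces \<open>j\<close> to be
    positive, so that \<open>3 ^ j / 2\<close> is at least 1 and the shift cannot overshoot the
    tolerance.\<close>
  obtain j where "j \<in> J" "Suc n \<le> j" using J infinite_nat_iff_unbounded_le by metis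
  have "\<forall>m\<in>J. \<exists>z::int. \<bar>x - z / 3 ^ p m\<bar> \<le> 3 ^ m / (2 * 3 ^ p (Suc m))"
    using x by (auto simp: ternary_set_def level_set_def)
  then obtain z :: "nat \<Rightarrow> int"
    where z: "\<And>m. m \<in> J \<Longrightarrow> \<bar>x - z m / 3 ^ p m\<bar> \<le> 3 ^ m / (2 * 3 ^ p (Suc m))" by metis
  let ?s = "1 / 3 ^ p (Suc j) :: real"
  define \<sigma> :: int where "\<sigma> = (if x \<ge> z j / 3 ^ p j then -1 else 1)"
  define y where "y = x + \<sigma> * ?s"
  have s_le: "?s \<le> 3 ^ j / (2 * 3 ^ p (Suc j))"
  proof -
    have "(3::real) ^ 1 \<le> 3 ^ j" using \<open>Suc n \<le> j\<close> by (intro power_increasing) auto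
    then show ?thesis by (simp add: field_simps)
  qed
  have yj: "\<bar>y - z j / 3 ^ p j\<bar> \<le> 3 ^ j / (2 * 3 ^ p (Suc j))"
  proof (cases "x \<ge> z j / 3 ^ p j")
    case True
    then have "y = x - ?s" by (simp add: y_def \<sigma>_def)
    moreover have "?s > 0" by simp
    ultimately show ?thesis using z[OF \<open>j \<in> J\<close>] s_le True by linarith
  next
    case False
    then have "y = x + ?s" by (simp add: y_def \<sigma>_def)
    moreover have "?s > 0" by simp
    ultimately show ?thesis using z[OF \<open>j \<in> J\<close>] s_le False by linarith
  qed
  have "y \<in> level_set p m" if "m \<in> J" for m
  proof -
    consider "m < j" | "m = j" | "j < m" by linarith
    then show ?thesis
    proof cases
      case 1
      then show ?thesis
        using finer_interval_subset[OF p 1 z[OF \<open>m \<in> J\<close>] z[OF \<open>j \<in> J\<close>] yj]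
        by (auto simp: level_set_def)
    next
      case 2
      then show ?thesis using yj by (auto simp: level_set_def)
    next
      case 3
      define k where "k = p m - p (Suc j)"
      have k: "p m = p (Suc j) + k" using fast_growing_mono[OF p, of "Suc j" m] 3 by (auto simp: k_def)
      have "y - of_int (z m + \<sigma> * 3 ^ k) / 3 ^ p m = x - z m / 3 ^ p m"
        unfolding y_def k by (simp add: power_add field_simps)
      then show ?thesis using z[OF \<open>m \<in> J\<close>] unfolding level_set_def by (metis (mono_tags) mem_Collect_eq)
    qed
  qed
  then have "y \<in> ternary_set p J" by (simp add: ternary_set_def)
  moreover have "y \<noteq> x" by (simp add: y_def \<sigma>_def)
  moreover have "\<bar>y - x\<bar> < \<epsilon>"
  proof -
    have "n \<le> p (Suc j)" using fast_growing_le[OF p, of "Suc j"] \<open>Suc n \<le> j\<close> by linarith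
    then have "(1 / 3 :: real) ^ p (Suc j) \<le> (1 / 3) ^ n" by (intro power_decreasing) auto
    then show ?thesis using n by (simp add: y_def \<sigma>_def power_one_over)
  qed
  ultimately show ?thesis by blast
qed

section \<open>The product set in the coordinate space\<close>

definition ternary_grid :: "(nat \<Rightarrow> nat) \<Rightarrow> nat set \<Rightarrow> (real ^ 'n) set" where
  "ternary_grid p J = {x. \<forall>c. x $ c \<in> ternary_set p J}"

lemma closed_ternary_grid: "closed (ternary_grid p J)"
proof -
  have "closed ((\<lambda>x. x $ c) -` ternary_set p J :: (real ^ 'n) set)" for c
    by (intro continuous_closed_vimage closed_ternary_set) (auto intro: continuous_intros)
  moreover have "ternary_grid p J = (\<Inter>c. (\<lambda>x. x $ c) -` ternary_set p J :: (real ^ 'n) set)"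
    by (auto simp: ternary_grid_def)
  ultimately show ?thesis by (metis closed_INT)
qed

text \<open>Moving a single coordinate is enough.\<close>

lemma ternary_grid_accumulates:
  fixes x :: "real ^ 'n"
  assumes "fast_growing p" "infinite J" "x \<in> ternary_grid p J" "\<epsilon> > 0"
  shows "\<exists>y\<in>ternary_grid p J. y \<noteq> x \<and> dist y x < \<epsilon>"
proof -
  fix c :: 'n
  obtain u where u: "u \<in> ternary_set p J" "u \<noteq> x $ c" "\<bar>u - x $ c\<bar> < \<epsilon>"
    using ternary_set_accumulates[of p J "x $ c" \<epsilon>] assms by (auto simp: ternary_grid_def)
  define y where "y = (\<chi> i. if i = c then u else x $ i)"
  have "y \<in> ternary_grid p J" using assms u by (auto simp: ternary_grid_def y_def)
  moreover have "y $ c \<noteq> x $ c" using u by (simp add: y_def)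
  moreover have "y - x = axis c (u - x $ c)" by (auto simp: y_def vec_eq_iff axis_def)
  then have "dist y x < \<epsilon>" using u norm_le_l1_cart[of "y - x"]
    by (simp add: dist_norm axis_def if_distrib[of abs] cong: if_cong)
  ultimately show ?thesis by metis
qed

section \<open>Null sets\<close>

text \<open>Nullity without the operator \<open>Lim\<close>: arbitrarily cheap coverings exist at
  every scale, so the infimum vanishes for each positive \<delta> and not merely in the
  limit.\<close>

definition h_null :: "(real \<Rightarrow> ennreal) \<Rightarrow> 'a::metric_space set \<Rightarrow> bool" where
  "h_null h E \<longleftrightarrow> (\<forall>\<delta>>0. \<forall>\<epsilon>>0. \<exists>U. delta_covering \<delta> E U \<and> (\<Sum>i. h (diameter (U i))) \<le> ennreal \<epsilon>)"

lemma hausdorff_measure_eq_0: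
  assumes "h_null h E"
  shows "hausdorff_measure h E = 0"
proof -
  let ?m = "\<lambda>\<delta>. INF U\<in>{U. delta_covering \<delta> E U}. \<Sum>i. h (diameter (U i))"
  have "?m \<delta> = 0" if "\<delta> > 0" for \<delta>
  proof -
    have "?m \<delta> \<le> 0 + ennreal \<epsilon>" if "\<epsilon> > 0" for \<epsilon>
      using assms \<open>\<delta> > 0\<close> that unfolding h_null_def by (auto intro: INF_lower2)
    then have "?m \<delta> \<le> 0" by (rule ennreal_le_epsilon)
    then show ?thesis by (simp only: le_zero_eq)
  qed
  then have "eventually (\<lambda>\<delta>. ?m \<delta> = 0) (at_right 0)"
    by (auto intro: eventually_at_right_less[of 0, THEN eventually_mono])
  then have "(?m \<longlongrightarrow> 0) (at_right 0)" by (rule tendsto_eventually)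
  then show ?thesis unfolding hausdorff_measure_def by (intro tendsto_Lim) auto
qed

lemma h_null_subset:
  assumes "h_null h E" "D \<subseteq> E"
  shows "h_null h D"
  using assms unfolding h_null_def delta_covering_def by (meson order_trans)

text \<open>The n-th set receives the budget \<open>\<epsilon> / 2 ^ (n + 1)\<close>; a pairing of
  indices merges the coverings into one sequence.\<close>

lemma h_null_UN:
  fixes E :: "nat \<Rightarrow> 'a::metric_space set"
  assumes "\<And>n. h_null h (E n)"
  shows "h_null h (\<Union>n. E n)"
  unfolding h_null_def
proof (intro allI impI)
  fix \<delta> \<epsilon> :: real assume "\<delta> > 0" "\<epsilon> > 0"
  have "\<exists>U. delta_covering \<delta> (E n) U \<and> (\<Sum>i. h (diameter (U i))) \<le> ennreal (\<epsilon> * (1 / 2) ^ Suc n)" for n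
  proof -
    have "\<epsilon> * (1 / 2) ^ Suc n > 0" using \<open>\<epsilon> > 0\<close> by simp
    then show ?thesis using assms[of n] \<open>\<delta> > 0\<close> unfolding h_null_def by blast
  qed
  then obtain U where U: "\<And>n. delta_covering \<delta> (E n) (U n)"
    and sum: "\<And>n. (\<Sum>i. h (diameter (U n i))) \<le> ennreal (\<epsilon> * (1 / 2) ^ Suc n)" by metis
  define V where "V i = (case prod_decode i of (n, k) \<Rightarrow> U n k)" for i
  have "x \<in> (\<Union>i. V i)" if "x \<in> E n" for x n
  proof -
    have "x \<in> (\<Union>k. U n k)" using U[of n] that unfolding delta_covering_def by (meson subsetD)
    then obtain k where "x \<in> U n k" by blast
    then have "x \<in> V (prod_encode (n, k))" by (simp add: V_def)
    then show ?thesis by blast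
  qed
  then have "delta_covering \<delta> (\<Union>n. E n) V"
    using U by (auto simp: delta_covering_def V_def split: prod.split)
  moreover have "(\<Sum>i. h (diameter (V i))) \<le> ennreal \<epsilon>"
  proof -
    have "(\<Sum>i. h (diameter (V i))) = (\<Sum>i. (\<lambda>(n, k). h (diameter (U n k))) (prod_decode i))"
      by (intro suminf_cong) (auto simp: V_def split: prod.split)
    also have "\<dots> = (\<Sum>n. \<Sum>k. h (diameter (U n k)))" by (intro suminf_ennreal_2dimen) simp
    also have "\<dots> \<le> (\<Sum>n. ennreal (\<epsilon> * (1 / 2) ^ Suc n))" by (intro suminf_le sum) auto
    also have "\<dots> = ennreal \<epsilon>"
    proof (rule suminf_ennreal_eq)
      show "(\<lambda>n. \<epsilon> * (1 / 2) ^ Suc n) sums \<epsilon>" using sums_mult[OF power_half_series, of \<epsilon>] by simp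
    qed (use \<open>\<epsilon> > 0\<close> in auto)
    finally show ?thesis .
  qed
  ultimately show "\<exists>U. delta_covering \<delta> (\<Union>n. E n) U \<and> (\<Sum>i. h (diameter (U i))) \<le> ennreal \<epsilon>"
    by blast
qed

lemma h_null_Union:
  assumes "dimension_function h" "countable \<E>" "\<And>E. E \<in> \<E> \<Longrightarrow> h_null h E"
  shows "h_null h (\<Union>\<E>)"
proof (cases "\<E> = {}")
  case True
  have "delta_covering \<delta> {} (\<lambda>_. {})" if "\<delta> > 0" for \<delta> :: real
    using that by (simp add: delta_covering_def)
  moreover have "h 0 = 0" using assms(1) by (simp add: dimension_function_def)
  then have "(\<Sum>i::nat. h (diameter ({} :: 'a set))) \<le> ennreal \<epsilon>" for \<epsilon> by simp
  ultimately show ?thesis unfolding True Union_empty h_null_def by (intro allI impI exI conjI)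
next
  case False
  then have "h_null h (\<Union>n. from_nat_into \<E> n)"
    by (intro h_null_UN assms(3) from_nat_into)
  then show ?thesis using range_from_nat_into[OF False assms(2)] by simp
qed

section \<open>Cell counts and the choice of the scales\<close>

lemma finite_covering:
  fixes W :: "'i \<Rightarrow> 'a::real_normed_vector set"
  assumes h: "dimension_function h" and I: "finite I" and "E \<subseteq> (\<Union>i\<in>I. W i)"
    and W: "\<And>i x y. \<lbrakk>i \<in> I; x \<in> W i; y \<in> W i\<rbrakk> \<Longrightarrow> dist x y \<le> d" and "0 \<le> d" "d \<le> \<delta>"
  shows "\<exists>U. delta_covering \<delta> E U \<and> (\<Sum>i. h (diameter (U i))) \<le> of_nat (card I) * h d"
proof -
  obtain e where e: "bij_betw e {0..<card I} I" using ex_bij_betw_nat_finite[OF I] by blast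
  \<comment> \<open>Padding by empty sets costs nothing, since they have diameter 0 and
    \<open>h 0 = 0\<close>.\<close>
  define U where "U n = (if n < card I then W (e n) else {})" for n
  have eI: "e n \<in> I" if "n < card I" for n using e that by (auto simp: bij_betw_def)
  have mono: "h s \<le> h t" if "0 \<le> s" "s \<le> t" for s t
    using h that by (auto simp: dimension_function_def mono_on_def)
  have bdd: "bounded (U n) \<and> diameter (U n) \<le> d" for n
  proof (cases "n < card I")
    case True
    then have "\<forall>x\<in>W (e n). \<forall>y\<in>W (e n). dist x y \<le> d" using W[OF eI[OF True]] by blast
    then have "bounded (W (e n))" unfolding bounded_two_points by (rule exI)
    moreover have "diameter (W (e n)) \<le> d"
      using W[OF eI[OF True]] \<open>0 \<le> d\<close> by (intro diameter_le) (auto simp: dist_norm)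
    ultimately show ?thesis using True by (simp add: U_def)
  qed (use \<open>0 \<le> d\<close> in \<open>simp add: U_def\<close>)
  have "E \<subseteq> (\<Union>n. U n)"
  proof
    fix x assume "x \<in> E"
    then obtain i where "i \<in> I" "x \<in> W i" using assms(3) by auto
    then have "i \<in> e ` {0..<card I}" using e by (simp only: bij_betw_def)
    then obtain n where "n < card I" "i = e n" by auto
    then have "x \<in> U n" using \<open>x \<in> W i\<close> by (simp add: U_def)
    then show "x \<in> (\<Union>n. U n)" by (rule UN_I[OF UNIV_I])
  qed
  then have "delta_covering \<delta> E U"
    using bdd \<open>d \<le> \<delta>\<close> unfolding delta_covering_def by (meson order_trans)
  moreover have "(\<Sum>n. h (diameter (U n))) = (\<Sum>n<card I. h (diameter (U n)))"
    using h by (intro suminf_finite) (auto simp: U_def dimension_function_def)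
  moreover have "\<dots> \<le> (\<Sum>n<card I. h d)"
    by (intro sum_mono mono) (auto simp: bdd diameter_ge_0)
  ultimately show ?thesis by auto
qed

text \<open>These are the numerators of the points of mesh \<open>1 / 3 ^ q\<close> in the cube of
  half-side \<open>j + 1\<close>; the extra 1 makes room for the tolerance around points of the cube
  of half-side \<open>j\<close>.\<close>

definition box_lattice :: "nat \<Rightarrow> nat \<Rightarrow> ('n \<Rightarrow> int) set" where
  "box_lattice q j = {v. \<forall>c. \<bar>v c\<bar> \<le> int ((j + 1) * 3 ^ q)}"

lemma finite_box_lattice: "finite (box_lattice q j :: ('n::finite \<Rightarrow> int) set)"
proof -
  let ?B = "int ((j + 1) * 3 ^ q)"
  have "box_lattice q j \<subseteq> (PiE UNIV (\<lambda>_. {- ?B..?B}) :: ('n \<Rightarrow> int) set)"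
  proof
    fix v :: "'n \<Rightarrow> int" assume "v \<in> box_lattice q j"
    then have "\<bar>v c\<bar> \<le> ?B" for c unfolding box_lattice_def by blast
    then have "v c \<in> {- ?B..?B}" for c unfolding atLeastAtMost_iff by (metis abs_le_iff minus_le_iff)
    then show "v \<in> PiE UNIV (\<lambda>_. {- ?B..?B})" unfolding PiE_UNIV_domain by blast
  qed
  then show ?thesis by (rule finite_subset) (intro finite_PiE finite_atLeastAtMost_int finite)
qed

text \<open>At level \<open>j\<close> the part of the grid in the box of size \<open>j\<close> has at most as many cells as
  \<open>box_lattice (p j) j\<close> has elements; the factor \<open>j\<close> in the argument of \<open>h\<close> absorbs every fixed
  Lipschitz constant.\<close>
definition h_adapted :: "'n::finite itself \<Rightarrow> (real \<Rightarrow> ennreal) \<Rightarrow> (nat \<Rightarrow> nat) \<Rightarrow> bool" where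
  "h_adapted n h p \<longleftrightarrow> (\<forall>j. real j * (3 ^ j / (2 * 3 ^ p (Suc j))) \<le> 1 / Suc j \<and>
     of_nat (card (box_lattice (p j) j :: ('n \<Rightarrow> int) set)) * h (real j * (3 ^ j / (2 * 3 ^ p (Suc j))))
       \<le> ennreal (1 / Suc j))"

text \<open>The scales are chosen recursively. Once \<open>p j\<close> is fixed, so is the number of
  cells, and right continuity of \<open>h\<close> at 0 makes the total cost small when
  \<open>p (Suc j)\<close> is large. In \<open>Q j q m\<close> the numbers \<open>q\<close> and
  \<open>m\<close> stand for these two exponents.\<close>

lemma ex_h_adapted:
  assumes h: "dimension_function h"
  shows "\<exists>p. fast_growing p \<and> h_adapted TYPE('n::finite) h p"
proof -
  define Q where "Q j q m \<longleftrightarrow> q + j + 2 \<le> m \<and> real j * (3 ^ j / (2 * 3 ^ m)) \<le> 1 / Suc j \<and>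
     of_nat (card (box_lattice q j :: ('n \<Rightarrow> int) set)) * h (real j * (3 ^ j / (2 * 3 ^ m)))
       \<le> ennreal (1 / Suc j)" for j q m
  have "\<exists>m. Q j q m" for j q
  proof -
    let ?M = "of_nat (card (box_lattice q j :: ('n \<Rightarrow> int) set)) :: ennreal"
    have "(h \<longlongrightarrow> 0) (at_right 0)"
      using h unfolding dimension_function_def continuous_within by (metis order_refl)
    then have "((\<lambda>t. ?M * h t) \<longlongrightarrow> ?M * 0) (at_right 0)"
      by (intro ennreal_tendsto_cmult) (auto simp: of_nat_less_top)
    then have "eventually (\<lambda>t. ?M * h t < ennreal (1 / Suc j)) (at_right 0)"
      by (intro order_tendstoD(2)[where y = "?M * 0"]) auto
    then have "eventually (\<lambda>t. ?M * h t < ennreal (1 / Suc j) \<and> 0 < t \<and> t < 1 / Suc j) (at_right 0)"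
      using eventually_at_right_real[of 0 "1 / Suc j"] by (auto elim: eventually_elim2)
    then obtain t where t: "?M * h t < ennreal (1 / Suc j)" "0 < t" "t < 1 / Suc j"
      using eventually_happens'[of "at_right (0::real)"] by auto
    \<comment> \<open>The summand 1 keeps the divisor positive at \<open>j = 0\<close>.\<close>
    have "real j * 3 ^ j + 1 > 0" by (simp add: add_nonneg_pos)
    then have "t / (real j * 3 ^ j + 1) > 0" using t(2) by simp
    then obtain n where "(1 / 3) ^ n < t / (real j * 3 ^ j + 1)"
      using real_arch_pow_inv[of "t / (real j * 3 ^ j + 1)" "1/3"] by auto
    define m where "m = max n (q + j + 2)"
    have "(1 / 3 :: real) ^ m \<le> (1 / 3) ^ n" by (intro power_decreasing) (auto simp: m_def)
    also note \<open>(1 / 3) ^ n < t / (real j * 3 ^ j + 1)\<close>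
    finally have "(real j * 3 ^ j + 1) * (1 / 3) ^ m < t"
      using \<open>real j * 3 ^ j + 1 > 0\<close> by (simp add: field_simps)
    moreover have "real j * (3 ^ j / (2 * 3 ^ m)) \<le> (real j * 3 ^ j + 1) * (1 / 3) ^ m"
      by (simp add: power_one_over field_simps)
    ultimately have le: "real j * (3 ^ j / (2 * 3 ^ m)) \<le> t" by linarith
    have "h (real j * (3 ^ j / (2 * 3 ^ m))) \<le> h t"
      using h le t(2) unfolding dimension_function_def by (intro mono_onD[of "{0..}" h]) auto
    then have "?M * h (real j * (3 ^ j / (2 * 3 ^ m))) \<le> ennreal (1 / Suc j)"
      using t(1) by (meson less_imp_le mult_left_mono order_trans zero_le)
    then have "Q j q m" using le t(3) unfolding Q_def by (auto simp: m_def)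
    then show ?thesis by blast
  qed
  then obtain g where "\<And>j q. Q j q (g j q)" by metis
  then have "\<forall>j. Q j (rec_nat 0 g j) (rec_nat 0 g (Suc j))" by simp
  then have "fast_growing (rec_nat 0 g) \<and> h_adapted TYPE('n) h (rec_nat 0 g)"
    unfolding Q_def fast_growing_def h_adapted_def by blast
  then show ?thesis by blast
qed

text \<open>A single large level \<open>j\<close> in \<open>J\<close> gives the covering: the cells
  around the lattice points of a box cover \<open>T\<close>, and their images have diameter at most
  \<open>j\<close> times the tolerance. The bounds in \<open>h_adapted\<close> then control both
  size and cost.\<close>

lemma h_null_lipschitz_image:
  fixes T :: "(real ^ 'n) set" and \<phi> :: "real ^ 'n \<Rightarrow> 'b::real_normed_vector"
  assumes h: "dimension_function h" and p: "fast_growing p" and ad: "h_adapted TYPE('n) h p"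
    and J: "infinite J" and T: "T \<subseteq> ternary_grid p J" "bounded T"
    and lip: "\<And>x y. \<lbrakk>x \<in> T; y \<in> T\<rbrakk> \<Longrightarrow> dist (\<phi> x) (\<phi> y) \<le> C * dist x y"
  shows "h_null h (\<phi> ` T)"
  unfolding h_null_def
proof (intro allI impI)
  fix \<delta> \<epsilon> :: real assume "\<delta> > 0" "\<epsilon> > 0"
  obtain R where R: "\<And>x. x \<in> T \<Longrightarrow> norm x \<le> R" using T(2) by (auto simp: bounded_iff)
  \<comment> \<open>Four demands on the level: \<open>T\<close> lies in the box of half-side
    \<open>j\<close>, \<open>j\<close> exceeds the Lipschitz constant times the dimensional factor,
    and \<open>1 / Suc j\<close> falls below both \<delta> and \<epsilon>.\<close>
  define m where "m = nat \<lceil>max (max R (2 * \<bar>C\<bar> * CARD('n))) (max (1 / \<delta>) (1 / \<epsilon>))\<rceil>"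
  obtain j where "j \<in> J" "m \<le> j" using J infinite_nat_iff_unbounded_le by metis
  have "max (max R (2 * \<bar>C\<bar> * CARD('n))) (max (1 / \<delta>) (1 / \<epsilon>)) \<le> real m"
    unfolding m_def by linarith
  then have "R \<le> real j" and Cj: "2 * \<bar>C\<bar> * CARD('n) \<le> real j" and "1 / \<delta> \<le> real j" "1 / \<epsilon> \<le> real j"
    using \<open>m \<le> j\<close> by auto
  then have \<delta>: "1 / Suc j \<le> \<delta>" and \<epsilon>: "1 / Suc j \<le> \<epsilon>"
    using \<open>\<delta> > 0\<close> \<open>\<epsilon> > 0\<close> by (auto simp: field_simps)
  let ?t = "(3::real) ^ j / (2 * 3 ^ p (Suc j))"
  define W where "W v = \<phi> ` {x \<in> T. \<forall>c. \<bar>x $ c - v c / 3 ^ p j\<bar> \<le> ?t}" for v :: "'n \<Rightarrow> int"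
  have t1: "?t \<le> 1"
  proof -
    have "?t \<le> 1 / (18 * 3 ^ p j)" by (rule tolerance_le_mesh[OF p])
    also have "(1::real) \<le> 3 ^ p j" by simp
    then have "1 \<le> 18 * (3::real) ^ p j" by linarith
    then have "1 / (18 * 3 ^ p j) \<le> (1::real)" by simp
    finally show ?thesis .
  qed
  have cover: "\<phi> ` T \<subseteq> (\<Union>v\<in>box_lattice (p j) j. W v)"
  proof
    fix y assume "y \<in> \<phi> ` T"
    then obtain x where x: "x \<in> T" "y = \<phi> x" by blast
    then have "\<forall>c. \<exists>z::int. \<bar>x $ c - z / 3 ^ p j\<bar> \<le> ?t"
      using T(1) \<open>j \<in> J\<close> by (auto simp: ternary_grid_def ternary_set_def level_set_def)
    then obtain v :: "'n \<Rightarrow> int" where v: "\<And>c. \<bar>x $ c - v c / 3 ^ p j\<bar> \<le> ?t" by metis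
    have "\<bar>v c\<bar> \<le> int ((j + 1) * 3 ^ p j)" for c
    proof -
      have "\<bar>x $ c\<bar> \<le> real j"
        using R[OF x(1)] \<open>R \<le> real j\<close> component_le_norm_cart[of x c] by linarith
      then have "\<bar>v c / 3 ^ p j\<bar> \<le> real j + 1" using v[of c] t1 by linarith
      then have "\<bar>real_of_int (v c)\<bar> \<le> (real j + 1) * 3 ^ p j" by (simp add: field_simps)
      then have "real_of_int \<bar>v c\<bar> \<le> real_of_int (int ((j + 1) * 3 ^ p j))"
        by (simp add: algebra_simps)
      then show ?thesis by (simp only: of_int_le_iff)
    qed
    then have "v \<in> box_lattice (p j) j" by (simp add: box_lattice_def)
    moreover have "y \<in> W v" using x v by (auto simp: W_def)
    ultimately show "y \<in> (\<Union>v\<in>box_lattice (p j) j. W v)" by blast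
  qed
  have "dist a b \<le> real j * ?t" if ab: "a \<in> W v" "b \<in> W v" for a b v
  proof -
    obtain x y where xy: "a = \<phi> x" "b = \<phi> y" "x \<in> T" "y \<in> T"
      and x: "\<And>c. \<bar>x $ c - v c / 3 ^ p j\<bar> \<le> ?t" and y: "\<And>c. \<bar>y $ c - v c / 3 ^ p j\<bar> \<le> ?t"
      using ab by (auto simp: W_def)
    have "\<bar>(x - y) $ c\<bar> \<le> 2 * ?t" for c using x[of c] y[of c] by simp
    then have "(\<Sum>c\<in>UNIV. \<bar>(x - y) $ c\<bar>) \<le> CARD('n) * (2 * ?t)"
      by (intro sum_bounded_above) auto
    then have "dist x y \<le> CARD('n) * (2 * ?t)"
      using norm_le_l1_cart[of "x - y"] by (simp add: dist_norm)
    then have "\<bar>C\<bar> * dist x y \<le> \<bar>C\<bar> * (CARD('n) * (2 * ?t))" by (intro mult_left_mono) auto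
    also have "\<dots> = 2 * \<bar>C\<bar> * CARD('n) * ?t" by simp
    also have "\<dots> \<le> real j * ?t" using Cj by (intro mult_right_mono) auto
    finally have "\<bar>C\<bar> * dist x y \<le> real j * ?t" .
    moreover have "C * dist x y \<le> \<bar>C\<bar> * dist x y" by (intro mult_right_mono) auto
    ultimately show ?thesis using lip[OF xy(3,4)] unfolding xy(1,2) by (meson order_trans)
  qed
  moreover have "real j * ?t \<le> 1 / Suc j" using ad unfolding h_adapted_def by blast
  then have "real j * ?t \<le> \<delta>" using \<delta> by linarith
  ultimately obtain U where "delta_covering \<delta> (\<phi> ` T) U"
    and "(\<Sum>i. h (diameter (U i))) \<le> of_nat (card (box_lattice (p j) j :: ('n \<Rightarrow> int) set)) * h (real j * ?t)"
    using finite_covering[OF h finite_box_lattice cover, of "real j * ?t" \<delta>] by auto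
  moreover have "of_nat (card (box_lattice (p j) j :: ('n \<Rightarrow> int) set)) * h (real j * ?t) \<le> ennreal (1 / Suc j)"
    using ad unfolding h_adapted_def by blast
  moreover have "ennreal (1 / Suc j) \<le> ennreal \<epsilon>" using \<epsilon> by (rule ennreal_leI)
  ultimately have "delta_covering \<delta> (\<phi> ` T) U \<and> (\<Sum>i. h (diameter (U i))) \<le> ennreal \<epsilon>"
    by (auto intro: order_trans)
  then show "\<exists>U. delta_covering \<delta> (\<phi> ` T) U \<and> (\<Sum>i. h (diameter (U i))) \<le> ennreal \<epsilon>"
    by (rule exI[of _ U])
qed

text \<open>By the Lindelof property countably many balls with a Lipschitz bound cover the domain,
  and a countable union of null sets is null.\<close>

lemma h_null_locally_bilipschitz_image:
  fixes \<Omega> :: "(real ^ 'n) set" and \<phi> :: "real ^ 'n \<Rightarrow> 'b::real_normed_vector"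
  assumes h: "dimension_function h" and p: "fast_growing p" and ad: "h_adapted TYPE('n) h p"
    and J: "infinite J" and loc: "locally_bilipschitz_on \<Omega> \<phi>"
  shows "h_null h (\<phi> ` (ternary_grid p J \<inter> \<Omega>))"
proof -
  have "\<forall>x\<in>\<Omega>. \<exists>\<epsilon>>0. \<exists>c1 c2. bilipschitz_on c1 c2 (ball x \<epsilon> \<inter> \<Omega>) \<phi>"
    using loc by (simp add: locally_bilipschitz_on_def)
  then obtain \<epsilon> c1 c2 where \<epsilon>: "\<And>x. x \<in> \<Omega> \<Longrightarrow> \<epsilon> x > 0"
    and bl: "\<And>x. x \<in> \<Omega> \<Longrightarrow> bilipschitz_on (c1 x) (c2 x) (ball x (\<epsilon> x) \<inter> \<Omega>) \<phi>" by metis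
  obtain \<F> where \<F>: "\<F> \<subseteq> (\<lambda>x. ball x (\<epsilon> x)) ` \<Omega>" "countable \<F>" "\<Union>\<F> = (\<Union>x\<in>\<Omega>. ball x (\<epsilon> x))"
    by (rule Lindelof[of "(\<lambda>x. ball x (\<epsilon> x)) ` \<Omega>"]) auto
  have "\<exists>X. countable X \<and> X \<subseteq> \<Omega> \<and> \<F> = (\<lambda>x. ball x (\<epsilon> x)) ` X"
    using \<F>(1,2) unfolding countable_subset_image[symmetric] by (rule conjI[rotated])
  then obtain X where X: "X \<subseteq> \<Omega>" "countable X" "\<F> = (\<lambda>x. ball x (\<epsilon> x)) ` X" by (elim exE conjE)
  have "h_null h (\<phi> ` (ternary_grid p J \<inter> \<Omega> \<inter> ball x (\<epsilon> x)))" if "x \<in> X" for x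
  proof (rule h_null_lipschitz_image[OF h p ad J])
    show "dist (\<phi> u) (\<phi> v) \<le> c2 x * dist u v"
      if "u \<in> ternary_grid p J \<inter> \<Omega> \<inter> ball x (\<epsilon> x)" "v \<in> ternary_grid p J \<inter> \<Omega> \<inter> ball x (\<epsilon> x)" for u v
      using bl[of x] \<open>x \<in> X\<close> X(1) that by (auto simp: bilipschitz_on_def)
  qed (auto intro: bounded_subset[OF bounded_ball[of x "\<epsilon> x"]])
  then have "h_null h (\<Union>((\<lambda>x. \<phi> ` (ternary_grid p J \<inter> \<Omega> \<inter> ball x (\<epsilon> x))) ` X))"
    using X(2) by (intro h_null_Union[OF h]) auto
  moreover have "\<phi> ` (ternary_grid p J \<inter> \<Omega>) \<subseteq> \<Union>((\<lambda>x. \<phi> ` (ternary_grid p J \<inter> \<Omega> \<inter> ball x (\<epsilon> x))) ` X)"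
  proof
    fix y assume "y \<in> \<phi> ` (ternary_grid p J \<inter> \<Omega>)"
    then obtain u where u: "u \<in> ternary_grid p J" "u \<in> \<Omega>" "y = \<phi> u" by blast
    then have "u \<in> ball u (\<epsilon> u)" using \<epsilon>[of u] by simp
    then have "u \<in> \<Union>\<F>" using u(2) unfolding \<F>(3) by (rule UN_I[rotated])
    then show "y \<in> \<Union>((\<lambda>x. \<phi> ` (ternary_grid p J \<inter> \<Omega> \<inter> ball x (\<epsilon> x))) ` X)"
      using u unfolding X(3) by blast
  qed
  ultimately show ?thesis by (rule h_null_subset)
qed

section \<open>Common values of non-contractive maps\<close>

text \<open>The inverse of \<open>g\<close> on the ball around \<open>g x\<close> is Lipschitz and
  injective, so by invariance of domain its image is open. The trace of this image on
  \<open>cball x \<delta>\<close> is also closed, because the upper bound on \<open>g\<close>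
  confines it to the image of a smaller closed ball. Connectedness gives the whole of
  \<open>cball x \<delta>\<close>.\<close>

lemma cball_subset_bilipschitz_domain:
  fixes g :: "'a::euclidean_space \<Rightarrow> 'a"
  assumes bl: "bilipschitz_on c1 c2 \<Omega> g" and sub: "ball (g x) \<rho> \<subseteq> g ` \<Omega>" and x: "x \<in> \<Omega>"
    and \<delta>: "0 \<le> \<delta>" "c2 * \<delta> < \<rho>"
  shows "cball x \<delta> \<subseteq> \<Omega>"
proof -
  have c: "0 < c1" "0 < c2"
    and lo: "\<And>u v. \<lbrakk>u \<in> \<Omega>; v \<in> \<Omega>\<rbrakk> \<Longrightarrow> c1 * dist u v \<le> dist (g u) (g v)"
    and up: "\<And>u v. \<lbrakk>u \<in> \<Omega>; v \<in> \<Omega>\<rbrakk> \<Longrightarrow> dist (g u) (g v) \<le> c2 * dist u v"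
    using bl by (auto simp: bilipschitz_on_def)
  define k where "k = inv_into \<Omega> g"
  let ?B = "ball (g x) \<rho>"
  have inj: "inj_on g \<Omega>"
  proof (rule inj_onI)
    fix u v assume "u \<in> \<Omega>" "v \<in> \<Omega>" "g u = g v"
    then have "c1 * dist u v \<le> 0" using lo[of u v] by simp
    then show "u = v" using c(1) by (simp add: mult_le_0_iff)
  qed
  have gk: "k y \<in> \<Omega>" "g (k y) = y" if "y \<in> ?B" for y
    using sub that by (auto simp: k_def inv_into_into f_inv_into_f subsetD)
  have kg: "k (g u) = u" if "u \<in> \<Omega>" for u using inj that by (simp add: k_def)
  have "(1 / c1)-lipschitz_on ?B k"
  proof (rule lipschitz_onI)
    fix y z assume "y \<in> ?B" "z \<in> ?B"
    then show "dist (k y) (k z) \<le> 1 / c1 * dist y z"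
      using lo[of "k y" "k z"] gk[of y] gk[of z] c(1) by (simp add: field_simps)
  qed (use c in simp)
  then have cont: "continuous_on ?B k" by (rule lipschitz_on_continuous_on)
  have "inj_on k ?B" by (metis gk(2) inj_onI)
  then have W: "open (k ` ?B)" using cont by (intro invariance_of_domain) auto
  have "cball (g x) (c2 * \<delta>) \<subseteq> ?B" using \<delta>(2) by auto
  then have C: "compact (k ` cball (g x) (c2 * \<delta>))"
    using cont by (intro compact_continuous_image) (auto intro: continuous_on_subset)
  \<comment> \<open>Inside \<open>cball x \<delta>\<close> the open image and the compact image
    coincide, which makes the trace clopen.\<close>
  have eq: "cball x \<delta> \<inter> k ` ?B = cball x \<delta> \<inter> k ` cball (g x) (c2 * \<delta>)"
  proof (intro equalityI subsetI)
    fix u assume u: "u \<in> cball x \<delta> \<inter> k ` ?B"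
    then obtain y where y: "y \<in> ?B" "u = k y" by blast
    have "dist (g x) y \<le> c2 * dist x u" using up[OF x, of "k y"] gk[OF y(1)] y(2) by simp
    also have "\<dots> \<le> c2 * \<delta>" using u c by simp
    finally show "u \<in> cball x \<delta> \<inter> k ` cball (g x) (c2 * \<delta>)" using u y by auto
  next
    fix u assume "u \<in> cball x \<delta> \<inter> k ` cball (g x) (c2 * \<delta>)"
    then show "u \<in> cball x \<delta> \<inter> k ` ?B" using \<open>cball (g x) (c2 * \<delta>) \<subseteq> ?B\<close> by blast
  qed
  have "openin (top_of_set (cball x \<delta>)) (cball x \<delta> \<inter> k ` ?B)" using W by auto
  moreover have "closedin (top_of_set (cball x \<delta>)) (cball x \<delta> \<inter> k ` ?B)"
    unfolding eq by (intro closedin_closed_Int compact_imp_closed C)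
  moreover have "x \<in> cball x \<delta> \<inter> k ` ?B"
  proof -
    have "0 \<le> c2 * \<delta>" using c \<delta> by simp
    then have "g x \<in> ?B" using \<delta>(2) by simp
    then have "k (g x) \<in> k ` ?B" by (rule imageI)
    then show ?thesis using kg[OF x] \<delta>(1) by simp
  qed
  ultimately have "cball x \<delta> \<inter> k ` ?B = cball x \<delta>"
    using connected_cball[of x \<delta>] unfolding connected_clopen by (metis empty_iff)
  then have "cball x \<delta> \<subseteq> k ` ?B" by blast
  then show ?thesis using gk(1) by auto
qed

lemma ex_lattice_point_near:
  fixes x :: "real ^ 'n"
  shows "\<exists>v :: 'n \<Rightarrow> int. dist x (\<chi> c. v c / 3 ^ q) \<le> CARD('n) / 3 ^ q"
proof -
  define v where "v c = \<lfloor>x $ c * 3 ^ q\<rfloor>" for c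
  have "\<bar>(x - (\<chi> c. v c / 3 ^ q)) $ c\<bar> \<le> 1 / 3 ^ q" for c
  proof -
    have "\<bar>x $ c * 3 ^ q - v c\<bar> \<le> 1" unfolding v_def by linarith
    then have "\<bar>x $ c * 3 ^ q - v c\<bar> / 3 ^ q \<le> 1 / 3 ^ q" by (intro divide_right_mono) auto
    moreover have "(x - (\<chi> c. v c / 3 ^ q)) $ c = (x $ c * 3 ^ q - v c) / 3 ^ q"
      by (simp add: field_simps)
    ultimately show ?thesis by (simp add: abs_divide)
  qed
  then have "(\<Sum>c\<in>UNIV. \<bar>(x - (\<chi> c. v c / 3 ^ q)) $ c\<bar>) \<le> CARD('n) * (1 / 3 ^ q)"
    by (intro sum_bounded_above) auto
  then have "dist x (\<chi> c. v c / 3 ^ q) \<le> CARD('n) / 3 ^ q"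
    using norm_le_l1_cart[of "x - (\<chi> c. v c / 3 ^ q)"] by (simp add: dist_norm)
  then show ?thesis by blast
qed

text \<open>\<open>L\<close> depends only on the scales and the maps, so the labels
  \<open>\<iota>\<close> and then the ball can be chosen after it. Each level \<open>j\<close>
  serves only the map labelled \<open>\<kappa> j\<close>, so nested balls can meet the demands of
  all maps one level at a time.\<close>

lemma noncontractive_common_value:
  fixes g :: "'i \<Rightarrow> real ^ 'n \<Rightarrow> real ^ 'n"
  assumes p: "fast_growing p" and \<kappa>: "\<And>j. \<kappa> j \<le> j" and "finite I"
    and bl: "\<And>i. i \<in> I \<Longrightarrow> noncontractive_bilipschitz_on (\<Omega> i) (g i)"
  shows "\<exists>L. \<forall>\<iota> y0. inj_on \<iota> I \<longrightarrow> (\<forall>i\<in>I. L < \<iota> i \<and> ball y0 1 \<subseteq> g i ` \<Omega> i) \<longrightarrow>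
     (\<exists>y\<in>ball y0 1. \<forall>i\<in>I. \<forall>x\<in>\<Omega> i. g i x = y \<longrightarrow> x \<in> ternary_grid p {j. \<kappa> j = \<iota> i})"
proof -
  have "\<forall>i\<in>I. \<exists>c1 c2. 1 \<le> c1 \<and> bilipschitz_on c1 c2 (\<Omega> i) (g i)"
    using bl by (simp add: noncontractive_bilipschitz_on_def)
  then obtain c1 c2 where c1: "\<And>i. i \<in> I \<Longrightarrow> 1 \<le> c1 i"
    and bl': "\<And>i. i \<in> I \<Longrightarrow> bilipschitz_on (c1 i) (c2 i) (\<Omega> i) (g i)" by metis
  have up: "dist (g i u) (g i v) \<le> c2 i * dist u v" if "i \<in> I" "u \<in> \<Omega> i" "v \<in> \<Omega> i" for i u v
    using bl'[OF that(1)] that by (auto simp: bilipschitz_on_def)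
  have lo: "dist u v \<le> dist (g i u) (g i v)" if "i \<in> I" "u \<in> \<Omega> i" "v \<in> \<Omega> i" for i u v
  proof -
    have "1 * dist u v \<le> c1 i * dist u v" using c1[OF that(1)] by (intro mult_right_mono) auto
    also have "\<dots> \<le> dist (g i u) (g i v)" using bl'[OF that(1)] that by (auto simp: bilipschitz_on_def)
    finally show ?thesis by simp
  qed
  define C where "C = (\<Sum>i\<in>I. \<bar>c2 i\<bar>)"
  have C: "c2 i \<le> C" if "i \<in> I" for i
    using member_le_sum[of i I "\<lambda>i. \<bar>c2 i\<bar>"] that \<open>finite I\<close> by (auto simp: C_def)
  have "C \<ge> 0" by (auto simp: C_def intro: sum_nonneg)
  define t where "t j = (3::real) ^ j / (2 * 3 ^ p (Suc j))" for j
  have t_pos: "t j > 0" for j by (simp add: t_def)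
  \<comment> \<open>From level \<open>L\<close> on, the factor \<open>3 ^ j / 2\<close> in the
    tolerance dominates the common Lipschitz constant \<open>C\<close> times the dimension, plus 1
    for the next tolerance.\<close>
  obtain L where L: "2 * (C * CARD('n) + 1) < 3 ^ L"
    using real_arch_pow[of 3 "2 * (C * CARD('n) + 1)"] by auto
  have tL: "t L < 1"
  proof -
    have "t L \<le> 1 / (18 * 3 ^ p L)" unfolding t_def by (rule tolerance_le_mesh[OF p])
    also have "(1::real) \<le> 3 ^ p L" by simp
    then have "1 < 18 * (3::real) ^ p L" by linarith
    then have "1 / (18 * 3 ^ p L) < (1::real)" by simp
    finally show ?thesis .
  qed
  \<comment> \<open>Moving to a nearby point of the next lattice shifts the value by at most the
    first summand; the ball of radius \<open>t (Suc j)\<close> around the new value still fits into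
    the old one.\<close>
  have scale: "C * (CARD('n) / 3 ^ p (Suc j)) + t (Suc j) < t j" if "L \<le> j" for j
  proof -
    have "(3::real) ^ L \<le> 3 ^ j" using that by (intro power_increasing) auto
    then have "2 * (C * CARD('n) + 1) < 3 ^ j" using L by (rule less_le_trans[rotated])
    then have "C * CARD('n) + 1 < 3 ^ j / 2" by simp
    then have "(C * CARD('n) + 1) / 3 ^ p (Suc j) < 3 ^ j / 2 / 3 ^ p (Suc j)"
      by (intro divide_strict_right_mono) auto
    then have "C * (CARD('n) / 3 ^ p (Suc j)) + 1 / 3 ^ p (Suc j) < t j"
      by (simp add: t_def add_divide_distrib)
    moreover have "t (Suc j) \<le> 1 / (18 * 3 ^ p (Suc j))"
      unfolding t_def by (rule tolerance_le_mesh[OF p])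
    moreover have "1 / (18 * 3 ^ p (Suc j)) \<le> (1::real) / 3 ^ p (Suc j)"
      by (intro divide_left_mono) auto
    ultimately show ?thesis by linarith
  qed
  have "\<exists>y\<in>ball y0 1. \<forall>i\<in>I. \<forall>x\<in>\<Omega> i. g i x = y \<longrightarrow> x \<in> ternary_grid p {j. \<kappa> j = \<iota> i}"
    if inj: "inj_on \<iota> I" and \<iota>: "\<And>i. i \<in> I \<Longrightarrow> L < \<iota> i"
      and sub: "\<And>i. i \<in> I \<Longrightarrow> ball y0 1 \<subseteq> g i ` \<Omega> i" for \<iota> y0
  proof -
    define P where "P n y \<longleftrightarrow> cball y (t (L + n)) \<subseteq> ball y0 1" for n y
    \<comment> \<open>Besides nestedness, \<open>Q\<close> records that at a level assigned to a map
      the new centre is the value of this map at a lattice point of its domain.\<close>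
    define Q where "Q n y y' \<longleftrightarrow> cball y' (t (Suc (L + n))) \<subseteq> cball y (t (L + n)) \<and>
      (\<forall>i\<in>I. \<kappa> (Suc (L + n)) = \<iota> i \<longrightarrow>
        (\<exists>v :: 'n \<Rightarrow> int. (\<chi> c. v c / 3 ^ p (Suc (L + n))) \<in> \<Omega> i \<and>
           g i (\<chi> c. v c / 3 ^ p (Suc (L + n))) = y'))" for n y y'
    have step: "\<exists>y'. P (Suc n) y' \<and> Q n y y'" if Py: "P n y" for n y
    proof (cases "\<exists>i\<in>I. \<kappa> (Suc (L + n)) = \<iota> i")
      case False
      have "0 \<le> C * (CARD('n) / 3 ^ p (Suc (L + n)))" using \<open>C \<ge> 0\<close> by simp
      then have "t (Suc (L + n)) \<le> t (L + n)" using scale[of "L + n"] by linarith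
      then have "cball y (t (Suc (L + n))) \<subseteq> cball y (t (L + n))" by auto
      then show ?thesis using False Py by (intro exI[of _ y]) (auto simp: P_def Q_def)
    next
      case True
      then obtain i where i: "i \<in> I" "\<kappa> (Suc (L + n)) = \<iota> i" by blast
      \<comment> \<open>Injective labels prevent two maps from imposing different centres at the
        same level.\<close>
      have uniq: "i' = i" if "i' \<in> I" "\<kappa> (Suc (L + n)) = \<iota> i'" for i'
        using inj i that by (metis inj_onD)
      have "y \<in> cball y (t (L + n))" using t_pos[of "L + n"] by simp
      then have "y \<in> ball y0 1" using Py unfolding P_def by (rule subsetD[rotated])
      then obtain x where x: "x \<in> \<Omega> i" "y = g i x" using sub[OF i(1)] by blast
      obtain v :: "'n \<Rightarrow> int" where v: "dist x (\<chi> c. v c / 3 ^ p (Suc (L + n))) \<le> CARD('n) / 3 ^ p (Suc (L + n))"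
        using ex_lattice_point_near by blast
      let ?\<delta> = "CARD('n) / 3 ^ p (Suc (L + n)) :: real"
      let ?q = "(\<chi> c. v c / 3 ^ p (Suc (L + n))) :: real ^ 'n"
      have "c2 i * ?\<delta> \<le> C * ?\<delta>" using C[OF i(1)] by (intro mult_right_mono) auto
      then have c\<delta>: "c2 i * ?\<delta> + t (Suc (L + n)) < t (L + n)" using scale[of "L + n"] by linarith
      have "ball (g i x) (t (L + n)) \<subseteq> g i ` \<Omega> i"
        using Py sub[OF i(1)] ball_subset_cball unfolding P_def x(2) by blast
      \<comment> \<open>This keeps the nearby lattice point \<open>?q\<close> in the domain; the
        slack in \<open>c\<delta>\<close> gives the required
        \<open>c2 i * ?\<delta> < t (L + n)\<close>.\<close>
      then have "cball x ?\<delta> \<subseteq> \<Omega> i"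
        using c\<delta> t_pos[of "Suc (L + n)"] by (intro cball_subset_bilipschitz_domain[OF bl'[OF i(1)] _ x(1)]) auto
      then have q: "?q \<in> \<Omega> i" using v by auto
      have "dist y (g i ?q) \<le> c2 i * dist x ?q" using up[OF i(1) x(1) q] x(2) by simp
      also have "\<dots> \<le> c2 i * ?\<delta>"
        using v bl'[OF i(1)] by (intro mult_left_mono) (auto simp: bilipschitz_on_def)
      finally have "dist y (g i ?q) + t (Suc (L + n)) \<le> t (L + n)" using c\<delta> by linarith
      then have "cball (g i ?q) (t (Suc (L + n))) \<subseteq> cball y (t (L + n))"
        by (simp add: cball_subset_cball_iff dist_commute)
      moreover have "\<kappa> (Suc (L + n)) = \<iota> i' \<longrightarrow> i' = i" if "i' \<in> I" for i' using uniq that by blast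
      ultimately show ?thesis
        using Py q by (intro exI[of _ "g i ?q"]) (auto simp: P_def Q_def)
    qed
    have "P 0 y0" using tL by (auto simp: P_def)
    then obtain f where f: "\<And>n. P n (f n)" "\<And>n. Q n (f n) (f (Suc n))"
      using dependent_nat_choice[of P Q] step by blast
    define K where "K n = cball (f n) (t (L + n))" for n
    have "K (Suc n) \<subseteq> K n" for n using f(2)[of n] by (simp add: K_def Q_def)
    then have mono: "K n \<subseteq> K m" if "m \<le> n" for m n using that by (rule lift_Suc_antimono_le)
    have "\<Inter>(range K) \<noteq> {}"
      using mono t_pos by (intro compact_nest) (auto simp: K_def less_imp_le not_less)
    then obtain y where y: "\<And>n. y \<in> K n" by blast
    have "y \<in> ball y0 1" using y[of 0] f(1)[of 0] by (auto simp: K_def P_def)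
    moreover have "x \<in> ternary_grid p {j. \<kappa> j = \<iota> i}" if i: "i \<in> I" and x: "x \<in> \<Omega> i" "g i x = y" for i x
    proof -
      have "x $ c \<in> level_set p j" if "\<kappa> j = \<iota> i" for j c
      proof -
        \<comment> \<open>Every level constraining the preimage under \<open>g i\<close> comes after
          \<open>L\<close>, so the construction has dealt with it.\<close>
        have "L < j" using \<iota>[OF i] \<kappa>[of j] that by linarith
        then obtain n where n: "j = Suc (L + n)" using less_iff_Suc_add by auto
        have "\<kappa> (Suc (L + n)) = \<iota> i" using that n by simp
        then obtain v :: "'n \<Rightarrow> int" where v: "(\<chi> c. v c / 3 ^ p j) \<in> \<Omega> i" "g i (\<chi> c. v c / 3 ^ p j) = f (Suc n)"
          using f(2)[of n] i unfolding Q_def n by blast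
        \<comment> \<open>Non-contractivity transfers the tolerance from values to preimages without
          loss.\<close>
        have "dist x (\<chi> c. v c / 3 ^ p j) \<le> dist y (f (Suc n))"
          using lo[OF i x(1) v(1)] x(2) v(2) by simp
        also have "\<dots> \<le> t j" using y[of "Suc n"] by (simp add: K_def n dist_commute)
        finally have "\<bar>x $ c - v c / 3 ^ p j\<bar> \<le> t j"
          using component_le_norm_cart[of "x - (\<chi> c. v c / 3 ^ p j)" c] by (simp add: dist_norm)
        then show ?thesis by (auto simp: level_set_def t_def)
      qed
      then show ?thesis by (simp add: ternary_grid_def ternary_set_def)
    qed
    ultimately show ?thesis by blast
  qed
  then show ?thesis by blast
qed

section \<open>Assembly of the perfect set\<close>

text \<open>The radius \<open>\<rho> / (2 * c2)\<close> is half the critical one, hence admissible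
  for the previous inclusion of balls. Preimages of common values thus survive the restriction to
  interiors in the construction of the set.\<close>

lemma interior_bilipschitz_domain:
  fixes g :: "'a::euclidean_space \<Rightarrow> 'a"
  assumes bl: "bilipschitz_on c1 c2 \<Omega> g" and V: "open V" "V \<subseteq> g ` \<Omega>" and x: "x \<in> \<Omega>" "g x \<in> V"
  shows "x \<in> interior \<Omega>"
proof -
  have "c2 > 0" using bl by (simp add: bilipschitz_on_def)
  obtain \<rho> where \<rho>: "\<rho> > 0" "ball (g x) \<rho> \<subseteq> V" using V(1) x(2) openE by blast
  have "cball x (\<rho> / (2 * c2)) \<subseteq> \<Omega>"
    using \<rho> V(2) x(1) \<open>c2 > 0\<close> by (intro cball_subset_bilipschitz_domain[OF bl, of x \<rho>]) auto
  then show ?thesis using \<rho>(1) \<open>c2 > 0\<close> by (auto simp: mem_interior_cball intro!: exI[of _ "\<rho> / (2 * c2)"])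
qed

lemma closed_UN_locally_finite:
  fixes E :: "'i \<Rightarrow> 'a::real_normed_vector set"
  assumes cl: "\<And>i. i \<in> A \<Longrightarrow> closed (E i)" and fin: "\<And>R. finite {i \<in> A. E i \<inter> cball 0 R \<noteq> {}}"
  shows "closed (\<Union>i\<in>A. E i)"
proof -
  have "finite {U \<in> E ` A. U \<inter> ball x 1 \<noteq> {}}" for x
  proof (rule finite_subset)
    have "ball x 1 \<subseteq> cball 0 (norm x + 1)"
    proof
      fix y assume "y \<in> ball x 1"
      then show "y \<in> cball 0 (norm x + 1)"
        using norm_triangle_sub[of y x] by (simp add: dist_norm norm_minus_commute)
    qed
    then show "{U \<in> E ` A. U \<inter> ball x 1 \<noteq> {}} \<subseteq> E ` {i \<in> A. E i \<inter> cball 0 (norm x + 1) \<noteq> {}}"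
      by blast
  qed (intro finite_imageI fin)
  then have "\<exists>V. open V \<and> x \<in> V \<and> finite {U \<in> E ` A. U \<inter> V \<noteq> {}}" for x
    by (intro exI[of _ "ball x 1"]) simp
  then have "locally_finite_in euclidean (E ` A)" by (simp add: locally_finite_in_def)
  then have "closedin euclidean (\<Union>(E ` A))"
    using cl by (intro closedin_locally_finite_Union) auto
  then show ?thesis by simp
qed

lemma islimpt_inj_image:
  assumes "continuous_on S f" "inj_on f S" "x \<in> S" "x islimpt S"
  shows "f x islimpt f ` S"
proof (rule islimptI)
  fix T assume "f x \<in> T" "open T"
  then obtain A where A: "open A" "A \<inter> S = f -` T \<inter> S"
    using assms(1) unfolding continuous_on_open_invariant by blast
  then obtain y where "y \<in> S" "y \<in> A" "y \<noteq> x"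
    using assms(3,4) \<open>f x \<in> T\<close> unfolding islimpt_def by blast
  then show "\<exists>y\<in>f ` S. y \<in> T \<and> y \<noteq> f x" using A(2) assms(2,3) by (auto dest: inj_onD)
qed

text \<open>Accumulation survives intersection with an open set and passage to the closure. The
  pieces of the perfect set are therefore cut out by interiors and strict inequalities and closed
  only afterwards.\<close>

lemma ternary_grid_open_islimpt:
  fixes V :: "(real ^ 'n) set"
  assumes p: "fast_growing p" and J: "infinite J" and V: "open V"
    and x: "x \<in> closure (ternary_grid p J \<inter> V)"
  shows "x islimpt closure (ternary_grid p J \<inter> V)"
proof -
  have "u islimpt ternary_grid p J \<inter> V" if u: "u \<in> ternary_grid p J \<inter> V" for u
    unfolding islimpt_approachable
  proof (intro allI impI)
    fix e :: real assume "e > 0"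
    obtain d where d: "d > 0" "ball u d \<subseteq> V" using V u openE by blast
    obtain y where "y \<in> ternary_grid p J" "y \<noteq> u" "dist y u < min d e"
      using ternary_grid_accumulates[OF p J, of u "min d e"] u d(1) \<open>e > 0\<close> by auto
    then show "\<exists>x'\<in>ternary_grid p J \<inter> V. x' \<noteq> u \<and> dist x' u < e"
      using d(2) by (intro bexI[of _ y]) (auto simp: dist_commute)
  qed
  then have "x islimpt ternary_grid p J \<inter> V" using x by (auto simp: closure_def)
  then show ?thesis by (rule islimpt_subset) (rule closure_subset)
qed

lemma continuous_on_locally_bilipschitz:
  assumes "locally_bilipschitz_on \<Omega> f"
  shows "continuous_on \<Omega> f"
  unfolding continuous_on_eq_continuous_within
proof
  fix x assume "x \<in> \<Omega>"
  then obtain \<epsilon> c1 c2 where \<epsilon>: "\<epsilon> > 0" and bl: "bilipschitz_on c1 c2 (ball x \<epsilon> \<inter> \<Omega>) f"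
    using assms unfolding locally_bilipschitz_on_def by blast
  have "c2-lipschitz_on (ball x \<epsilon> \<inter> \<Omega>) f"
    using bl by (auto simp: bilipschitz_on_def intro!: lipschitz_onI)
  then have "continuous (at x within (ball x \<epsilon> \<inter> \<Omega>)) f"
    using \<open>x \<in> \<Omega>\<close> \<epsilon> by (metis Int_iff centre_in_ball continuous_on_eq_continuous_within lipschitz_on_continuous_on)
  moreover have "at x within (ball x \<epsilon> \<inter> \<Omega>) = at x within \<Omega>"
    using \<epsilon> by (intro at_within_nhd[of x "ball x \<epsilon>"]) auto
  ultimately show "continuous (at x within \<Omega>) f" by simp
qed

section \<open>Construction of the perfect set and proof of its properties\<close>

theorem theorem3p2:
  fixes h :: "real \<Rightarrow> ennreal"
    and F :: "(real ^ 'n \<Rightarrow> real ^ 'n) set"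
    and \<Omega> :: "nat \<Rightarrow> (real ^ 'n) set"
    and \<psi> :: "nat \<Rightarrow> real ^ 'n \<Rightarrow> real ^ 'n"
    and r :: "(real ^ 'n \<Rightarrow> real ^ 'n) \<Rightarrow> nat"
  assumes "dimension_function h"
    and "\<And>f. f \<in> F \<Longrightarrow> continuous_on UNIV f"
    and "\<And>k. closed (\<Omega> k)"
    and "\<And>k. closed_map (top_of_set (\<Omega> k)) euclidean (\<psi> k)"
    and "\<And>k. inj_on (\<psi> k) (\<Omega> k)"
    and "\<And>k. locally_bilipschitz_on (\<Omega> k) (\<psi> k)"
    and "\<And>k. filterlim (\<lambda>x. norm (\<psi> k x)) at_top (inf at_infinity (principal (\<Omega> k)))"
    and "\<And>f. f \<in> F \<Longrightarrow> noncontractive_bilipschitz_on (\<Omega> (r f)) (f \<circ> \<psi> (r f))"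
    and "\<And>G a. finite G \<Longrightarrow> G \<subseteq> F \<Longrightarrow> 0 < a \<Longrightarrow>
           contains_arbitrarily_large_balls
             (\<Inter>f\<in>G. (f \<circ> \<psi> (r f)) ` (\<Omega> (r f) \<inter> (UNIV - {x. \<forall>i. x $ i \<in> {-a<..<a}})))"
  shows "\<exists>E :: (real ^ 'n) set. perfect_set E \<and> hausdorff_measure h E = 0 \<and>
           (\<forall>G. finite G \<longrightarrow> G \<subseteq> F \<longrightarrow> (\<Inter>f\<in>G. f ` E) \<noteq> {})"
proof -
  note h = assms(1) and \<Omega> = assms(3) and closed_map = assms(4) and inj = assms(5)
    and loc = assms(6) and proper = assms(7) and noncontr = assms(8) and large = assms(9)
  obtain p where p: "fast_growing p" and ad: "h_adapted TYPE('n) h p" using ex_h_adapted[OF h] by blast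
  \<comment> \<open>The first component of the pairing splits the levels into infinitely many
    infinite classes and never exceeds the level itself, as required of
    \<open>\<kappa>\<close>.\<close>
  define J where "J i = {j. fst (prod_decode j) = i}" for i
  have J: "infinite (J i)" for i
  proof -
    have "inj (\<lambda>n. prod_encode (i, n))" by (auto intro: injI)
    then have "infinite (range (\<lambda>n. prod_encode (i, n)))" by (rule range_inj_infinite)
    moreover have "range (\<lambda>n. prod_encode (i, n)) \<subseteq> J i" by (auto simp: J_def)
    ultimately show ?thesis using finite_subset by blast
  qed
  have fst_le: "fst (prod_decode j) \<le> j" for j
    using le_prod_encode_1[of "fst (prod_decode j)" "snd (prod_decode j)"] by simp

  \<comment> \<open>Properness provides thresholds beyond which the image under
    \<open>\<psi> k\<close> stays at distance at least \<open>i + k\<close> from the origin; this is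
    the source of local finiteness.\<close>
  have "\<exists>b. \<forall>x\<in>\<Omega> k. b \<le> norm x \<longrightarrow> real (i + k) \<le> norm (\<psi> k x)" for i k
  proof -
    have "eventually (\<lambda>x. real (i + k) \<le> norm (\<psi> k x)) (inf at_infinity (principal (\<Omega> k)))"
      using proper[of k] by (simp add: filterlim_at_top)
    then show ?thesis unfolding eventually_inf_principal eventually_at_infinity by blast
  qed
  then have "\<forall>i k. \<exists>b. \<forall>x\<in>\<Omega> k. b \<le> norm x \<longrightarrow> real (i + k) \<le> norm (\<psi> k x)" by blast
  then obtain b where "\<forall>i k. \<forall>x\<in>\<Omega> k. b i k \<le> norm x \<longrightarrow> real (i + k) \<le> norm (\<psi> k x)"
    unfolding choice_iff by (rule exE)
  then have b: "real (i + k) \<le> norm (\<psi> k x)" if "x \<in> \<Omega> k" "b i k \<le> norm x" for i k x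
    using that by blast

  define V where "V i k = interior (\<Omega> k) \<inter> {x. b i k < norm x}" for i k
  define D where "D i k = closure (ternary_grid p (J i) \<inter> V i k)" for i k
  define P where "P = (\<lambda>(i, k). \<psi> k ` D i k)"
  define E where "E = (\<Union>q. P q)"
  have openV: "open (V i k)" for i k
    unfolding V_def by (intro open_Int open_interior open_Collect_less continuous_intros)
  have D_sub: "D i k \<subseteq> ternary_grid p (J i) \<inter> \<Omega> k \<inter> {x. b i k \<le> norm x}" for i k
    unfolding D_def
  proof (rule closure_minimal)
    show "ternary_grid p (J i) \<inter> V i k \<subseteq> ternary_grid p (J i) \<inter> \<Omega> k \<inter> {x. b i k \<le> norm x}"
      using interior_subset[of "\<Omega> k"] by (auto simp: V_def)
    show "closed (ternary_grid p (J i) \<inter> \<Omega> k \<inter> {x. b i k \<le> norm x})"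
      by (intro closed_Int closed_ternary_grid \<Omega> closed_Collect_le continuous_intros)
  qed
  have closedP: "closed (P (i, k))" for i k
  proof -
    have "closedin (top_of_set (\<Omega> k)) (D i k)"
      using D_sub[of i k] \<Omega>[of k] by (auto simp: closedin_closed_eq D_def)
    then have "closedin euclidean (\<psi> k ` D i k)" using closed_map[of k] by (simp add: closed_map_def)
    then show ?thesis by (simp add: P_def)
  qed
  have far: "real (i + k) \<le> norm y" if "y \<in> P (i, k)" for i k y
    using that D_sub[of i k] b[of _ k i] by (auto simp: P_def)
  have "closed E"
    unfolding E_def
  proof (rule closed_UN_locally_finite)
    fix R :: real
    \<comment> \<open>Only pieces with \<open>i + k \<le> R\<close> can meet this ball.\<close>
    have "{q \<in> UNIV. P q \<inter> cball 0 R \<noteq> {}} \<subseteq> {..nat \<lceil>R\<rceil>} \<times> {..nat \<lceil>R\<rceil>}"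
    proof
      fix q assume "q \<in> {q \<in> UNIV. P q \<inter> cball 0 R \<noteq> {}}"
      moreover obtain i k where q: "q = (i, k)" by (cases q)
      ultimately obtain y where "y \<in> P (i, k)" "norm y \<le> R" by auto
      then have "real (i + k) \<le> R" using far[of y i k] by linarith
      then have "i + k \<le> nat \<lceil>R\<rceil>" by linarith
      then show "q \<in> {..nat \<lceil>R\<rceil>} \<times> {..nat \<lceil>R\<rceil>}" by (simp add: q)
    qed
    then show "finite {q \<in> UNIV. P q \<inter> cball 0 R \<noteq> {}}" by (rule finite_subset) auto
  qed (use closedP in auto)
  moreover have "\<not> y isolated_in E" if y: "y \<in> E" for y
  proof -
    obtain q where "y \<in> P q" using y unfolding E_def by blast
    moreover obtain i k where q: "q = (i, k)" by (cases q)
    ultimately obtain x where x: "x \<in> D i k" "y = \<psi> k x" by (auto simp: P_def)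
    have "x islimpt D i k"
      using x(1) unfolding D_def by (rule ternary_grid_open_islimpt[OF p J openV])
    moreover have "D i k \<subseteq> \<Omega> k" using D_sub by blast
    ultimately have "y islimpt \<psi> k ` D i k"
      unfolding x(2) using x(1) continuous_on_locally_bilipschitz[OF loc] inj[of k]
      \<comment> \<open>Injectivity of \<open>\<psi> k\<close> keeps images of distinct nearby
        points distinct, so limit points are preserved.\<close>
      by (intro islimpt_inj_image) (auto intro: continuous_on_subset inj_on_subset)
    moreover have "P (i, k) \<subseteq> E" unfolding E_def by blast
    ultimately have "y islimpt E" by (simp add: P_def islimpt_subset)
    then show ?thesis by (simp add: isolated_in_islimpt_iff)
  qed
  ultimately have "perfect_set E" by (simp add: perfect_set_def)

  moreover have "hausdorff_measure h E = 0"
  proof (rule hausdorff_measure_eq_0)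
    have "h_null h (P q)" for q
    proof -
      obtain i k where q: "q = (i, k)" by (cases q)
      have "h_null h (\<psi> k ` (ternary_grid p (J i) \<inter> \<Omega> k))"
        by (rule h_null_locally_bilipschitz_image[OF h p ad J loc])
      moreover have "P q \<subseteq> \<psi> k ` (ternary_grid p (J i) \<inter> \<Omega> k)"
        using D_sub[of i k] by (auto simp: P_def q)
      ultimately show ?thesis by (rule h_null_subset)
    qed
    then show "h_null h E" unfolding E_def by (intro h_null_Union[OF h]) auto
  qed

  moreover have "(\<Inter>f\<in>G. f ` E) \<noteq> {}" if G: "finite G" "G \<subseteq> F" for G
  proof -
    define g where "g f = f \<circ> \<psi> (r f)" for f
    have bl: "noncontractive_bilipschitz_on (\<Omega> (r f)) (g f)" if "f \<in> G" for f
      using noncontr G(2) that by (auto simp: g_def)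
    obtain L where L: "\<forall>\<iota> y0. inj_on \<iota> G \<longrightarrow> (\<forall>f\<in>G. L < \<iota> f \<and> ball y0 1 \<subseteq> g f ` \<Omega> (r f)) \<longrightarrow>
        (\<exists>y\<in>ball y0 1. \<forall>f\<in>G. \<forall>x\<in>\<Omega> (r f). g f x = y \<longrightarrow>
          x \<in> ternary_grid p {j. fst (prod_decode j) = \<iota> f})"
      using noncontractive_common_value[where \<kappa> = "\<lambda>j. fst (prod_decode j)" and \<Omega> = "\<lambda>f. \<Omega> (r f)",
          OF p fst_le G(1) bl] by (rule exE)
    obtain e :: "_ \<Rightarrow> nat" where "inj_on e G" using finite_imp_inj_to_nat_seg[OF G(1)] by blast
    define \<iota> where "\<iota> f = Suc (L + e f)" for f
    have \<iota>: "inj_on \<iota> G" using \<open>inj_on e G\<close> by (auto simp: inj_on_def \<iota>_def)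
    \<comment> \<open>The cube is chosen after the labels: its half-side exceeds all thresholds, so
      points outside it have norm above them.\<close>
    define a where "a = 1 + (\<Sum>f\<in>G. \<bar>b (\<iota> f) (r f)\<bar>)"
    have a: "b (\<iota> f) (r f) < a" if "f \<in> G" for f
      using member_le_sum[of f G "\<lambda>f. \<bar>b (\<iota> f) (r f)\<bar>"] that G(1) by (auto simp: a_def)
    have "a > 0" by (auto simp: a_def intro: add_pos_nonneg sum_nonneg)
    define Q where "Q f = \<Omega> (r f) \<inter> (UNIV - {x. \<forall>i. x $ i \<in> {-a<..<a}})" for f
    obtain y0 where "ball y0 1 \<subseteq> (\<Inter>f\<in>G. g f ` Q f)"
      using large[OF G \<open>a > 0\<close>] unfolding contains_arbitrarily_large_balls_def g_def Q_def
      by (meson zero_less_one)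
    then have y0: "ball y0 1 \<subseteq> g f ` Q f" if "f \<in> G" for f using that by blast
    have y0\<Omega>: "ball y0 1 \<subseteq> g f ` \<Omega> (r f)" if "f \<in> G" for f using y0[OF that] by (auto simp: Q_def)
    have "\<forall>f\<in>G. L < \<iota> f \<and> ball y0 1 \<subseteq> g f ` \<Omega> (r f)"
      using y0\<Omega> by (simp add: \<iota>_def)
    then have "\<exists>y\<in>ball y0 1. \<forall>f\<in>G. \<forall>x\<in>\<Omega> (r f). g f x = y \<longrightarrow> x \<in> ternary_grid p (J (\<iota> f))"
      unfolding J_def by (rule L[THEN spec, THEN spec, THEN mp, OF \<iota>, THEN mp])
    then obtain y where y: "y \<in> ball y0 1"
      and grid: "\<And>f x. \<lbrakk>f \<in> G; x \<in> \<Omega> (r f); g f x = y\<rbrakk> \<Longrightarrow> x \<in> ternary_grid p (J (\<iota> f))"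
      by blast
    have "y \<in> f ` E" if f: "f \<in> G" for f
    proof -
      \<comment> \<open>Three facts place \<open>x\<close> in a piece of the construction: it is
        interior to the domain, it lies beyond the threshold, and it belongs to the grid of its
        label.\<close>
      obtain x where x: "x \<in> Q f" "g f x = y" using y0[OF f] y by blast
      then have "x \<in> \<Omega> (r f)" by (simp add: Q_def)
      obtain c1 c2 where c: "bilipschitz_on c1 c2 (\<Omega> (r f)) (g f)"
        using bl[OF f] unfolding noncontractive_bilipschitz_on_def by blast
      have "x \<in> interior (\<Omega> (r f))"
        using x(2) y by (intro interior_bilipschitz_domain[OF c open_ball y0\<Omega>[OF f] \<open>x \<in> \<Omega> (r f)\<close>]) simp
      moreover have "b (\<iota> f) (r f) < norm x"
      proof -
        obtain i where "x $ i \<notin> {-a<..<a}" using x(1) by (auto simp: Q_def)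
        then have "a \<le> \<bar>x $ i\<bar>" by auto
        then show ?thesis using a[OF f] component_le_norm_cart[of x i] by linarith
      qed
      ultimately have "x \<in> V (\<iota> f) (r f)" by (simp add: V_def)
      moreover have "x \<in> ternary_grid p (J (\<iota> f))" using grid[OF f \<open>x \<in> \<Omega> (r f)\<close> x(2)] .
      ultimately have "x \<in> D (\<iota> f) (r f)" unfolding D_def by (intro subsetD[OF closure_subset] IntI)
      then have "\<psi> (r f) x \<in> P (\<iota> f, r f)" by (simp add: P_def)
      then have "\<psi> (r f) x \<in> E" unfolding E_def by blast
      then show ?thesis using x(2) by (auto simp: g_def)
    qed
    then show ?thesis by blast
  qed
  ultimately show ?thesis by blast
qed

end
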